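(* For the uplink pinching-antenna system with $N>1$ pinching antennas, $$\mathcal R_{\mathrm M,\mathrm T}^{\mathrm U}\subseteq\mathcal R_{\mathrm M,\mathrm F}^{\mathrm U}\subseteq\mathcal C_{\mathrm M}^{\mathrm U}\subseteq\mathcal C_{\mathrm M,\mathrm{OB}}^{\mathrm U}.$$
   Context: Setting. Let $N>1$ be an integer; $\eta,\sigma^2,d,k_0,\lambda_{\mathrm g},\Delta,P_1,P_2>0$; $y_{\mathrm p}\in\mathbb R$; users at $[x_k,y_k,0]^{\mathsf T}$, $k=1,2$, with $x_1\le x_2$ and $[x_1,x_2]\subseteq[q_0,q_{\max}]$. Put $d_k^2=d^2+(y_k-y_{\mathrm p})^2$. The feasible set of antenna positions is $\mathcal P=\{\mathbf q=(q_1,\dots,q_N)\in[q_0,q_{\max}]^N:|q_n-q_{n'}|\ge\Delta\ \forall n\ne n'\}$, assumed nonempty. The effective channel of user $k$ is $$h_k(\mathbf q)=\frac1{\sqrt N}\sum_{n=1}^N\frac{\sqrt\eta\,e^{-\mathrm jk_0\sqrt{d_k^2+(x_k-q_n)^2}}}{\sqrt{d_k^2+(x_k-q_n)^2}}\,e^{-\mathrm j2\pi|q_n-q_0|/\lambda_{\mathrm g}}.$$ Let $r_k^{\mathrm U}(\mathbf q)=\log_2(1+P_k|h_k(\mathbf q)|^2/\sigma^2)$ and $r_{1,2}^{\mathrm U}(\mathbf q)=\log_2(1+(P_1|h_1(\mathbf q)|^2+P_2|h_2(\mathbf q)|^2)/\sigma^2)$. Let $\mathbf q_k^\diamond\in\arg\max_{\mathbf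 q\in\mathcal P}|h_k(\mathbf q)|^2$. $\mathrm{Conv}$ denotes the convex hull. Capacity region: $\mathcal C_{\mathrm M}^{\mathrm U}=\mathrm{Conv}(\bigcup_{\mathbf q\in\mathcal P}\mathcal C^{\mathrm U}(\mathbf q))$ with $\mathcal C^{\mathrm U}(\mathbf q)=\{(R_1,R_2):0\le R_k\le r_k^{\mathrm U}(\mathbf q),\ k=1,2,\ R_1+R_2\le r_{1,2}^{\mathrm U}(\mathbf q)\}$. TDMA region: $\mathcal R_{\mathrm M,\mathrm T}^{\mathrm U}=\bigcup_{\rho\in[0,1]}\{(R_1,R_2):0\le R_1\le\rho\, r_1^{\mathrm U}(\mathbf q_1^\diamond),\ 0\le R_2\le(1-\rho)\,r_2^{\mathrm U}(\mathbf q_2^\diamond)\}$. FDMA region: $\mathcal R_{\mathrm M,\mathrm F}^{\mathrm U}=\mathrm{Conv}(\bigcup_{\mathbf q\in\mathcal P}\bigcup_{\rho\in[0,1]}\{(R_1,R_2):0\le R_k\le R_k^\rho(\mathbf q),\ k=1,2\})$ with $R_1^\rho(\mathbf q)=\rho\log_2(1+\frac{P_1|h_1(\mathbf q)|^2}{\rho\sigma^2})$, $R_2^\rho(\mathbf q)=(1-\rho)\log_2(1+\frac{P_2|h_2(\mathbf q)|^2}{(1-\rho)\sigma^2})$, and $R_1^0\equiv0$, $R_2^1\equiv0$. Outer bound: let $f_\diamond(x)=\frac{P_1\eta/\sigma^2}{d_1^2+(x-x_1)^2}+\frac{P_2\eta/\sigma^2}{d_2^2+(x-x_2)^2}$, let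 $\mathcal X_\diamond$ be the set of critical points (zeros of the derivative) of $f_\diamond$ in $[x_1,x_2]$, and $r_\diamond^{\mathrm U}=\log_2(1+N\max_{x\in\mathcal X_\diamond\cup\{x_1,x_2\}}f_\diamond(x))$. Then $\mathcal C_{\mathrm M,\mathrm{OB}}^{\mathrm U}=\{(R_1,R_2):0\le R_k\le r_k^{\mathrm U}(\mathbf q_k^\diamond),\ k=1,2,\ R_1+R_2\le r_\diamond^{\mathrm U}\}$. *)

theory Defs
  imports "HOL-Analysis.Analysis"
begin

text \<open>
  Users are indexed by the natural numbers 1 and 2; the fields of function type are only
  ever read at these two indices. The field \<open>noise\<close> is the noise power \<open>\<sigma>\<^sup>2\<close> itself (not \<open>\<sigma>\<close>),
  \<open>wg_height\<close> and \<open>wg_y\<close> are the height \<open>d\<close> and the lateral coordinate \<open>y\<^sub>p\<close> of the waveguide,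
  and \<open>q_start\<close>, \<open>q_end\<close> are \<open>q\<^sub>0\<close> and \<open>q\<^sub>m\<^sub>a\<^sub>x\<close>.
\<close>

record uplink_system =
  num_ant :: nat
  path_gain :: real          (* eta *)
  noise :: real              (* sigma^2 *)
  wg_height :: real          (* d *)
  wg_y :: real               (* y_p *)
  wavenum :: real            (* k_0 *)
  guide_wavelen :: real      (* lambda_g *)
  spacing :: real            (* Delta *)
  q_start :: real            (* q_0 *)
  q_end :: real              (* q_max *)
  tx_power :: "nat \<Rightarrow> real"     (* P_k *)
  user_x :: "nat \<Rightarrow> real"    (* x_k *)
  user_y :: "nat \<Rightarrow> real"    (* y_k *)

text \<open>The squared distance \<open>d\<^sub>k\<^sup>2\<close> of user \<open>k\<close> from the waveguide line.\<close>

definition dist_sq :: "uplink_system \<Rightarrow> nat \<Rightarrow> real" where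
  "dist_sq S k = (wg_height S)\<^sup>2 + (user_y S k - wg_y S)\<^sup>2"

text \<open>
  Position vectors in \<open>\<real>\<^sup>N\<close> are functions on \<open>{1..N}\<close>, made unique by extensionality.
\<close>

definition positions :: "uplink_system \<Rightarrow> (nat \<Rightarrow> real) set" where
  "positions S =
     {q \<in> {1..num_ant S} \<rightarrow>\<^sub>E {q_start S..q_end S}.
        \<forall>n\<in>{1..num_ant S}. \<forall>m\<in>{1..num_ant S}. n \<noteq> m \<longrightarrow> \<bar>q n - q m\<bar> \<ge> spacing S}"

definition channel :: "uplink_system \<Rightarrow> nat \<Rightarrow> (nat \<Rightarrow> real) \<Rightarrow> complex" where
  "channel S k q =
     complex_of_real (1 / sqrt (real (num_ant S))) *
     (\<Sum>n=1..num_ant S.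
        complex_of_real (sqrt (path_gain S)) *
        exp (- \<i> * complex_of_real (wavenum S * sqrt (dist_sq S k + (user_x S k - q n)\<^sup>2))) /
        complex_of_real (sqrt (dist_sq S k + (user_x S k - q n)\<^sup>2)) *
        exp (- \<i> * complex_of_real (2 * pi * \<bar>q n - q_start S\<bar> / guide_wavelen S)))"

definition gain :: "uplink_system \<Rightarrow> nat \<Rightarrow> (nat \<Rightarrow> real) \<Rightarrow> real" where
  "gain S k q = (cmod (channel S k q))\<^sup>2"

definition user_rate :: "uplink_system \<Rightarrow> nat \<Rightarrow> (nat \<Rightarrow> real) \<Rightarrow> real" where
  "user_rate S k q = log 2 (1 + tx_power S k * gain S k q / noise S)"

definition sum_rate :: "uplink_system \<Rightarrow> (nat \<Rightarrow> real) \<Rightarrow> real" where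
  "sum_rate S q = log 2 (1 + (tx_power S 1 * gain S 1 q + tx_power S 2 * gain S 2 q) / noise S)"

definition capacity_at :: "uplink_system \<Rightarrow> (nat \<Rightarrow> real) \<Rightarrow> (real \<times> real) set" where
  "capacity_at S q =
     {(R1, R2). 0 \<le> R1 \<and> R1 \<le> user_rate S 1 q \<and> 0 \<le> R2 \<and> R2 \<le> user_rate S 2 q \<and>
        R1 + R2 \<le> sum_rate S q}"

definition capacity_region :: "uplink_system \<Rightarrow> (real \<times> real) set" where
  "capacity_region S = convex hull (\<Union>q\<in>positions S. capacity_at S q)"

text \<open>
  In \<open>tdma_region\<close> and \<open>outer_bound\<close>, \<open>qopt k\<close> is a position vector maximising the gain of
  user \<open>k\<close>.
\<close>

definition tdma_region :: "uplink_system \<Rightarrow> (nat \<Rightarrow> nat \<Rightarrow> real) \<Rightarrow> (real \<times> real) set" where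
  "tdma_region S qopt =
     (\<Union>\<rho>\<in>{0..1}. {(R1, R2). 0 \<le> R1 \<and> R1 \<le> \<rho> * user_rate S 1 (qopt 1) \<and>
                          0 \<le> R2 \<and> R2 \<le> (1 - \<rho>) * user_rate S 2 (qopt 2)})"

text \<open>
  The FDMA rate of a user holding the bandwidth share \<open>w\<close>; user 1 has \<open>w = \<rho>\<close> and
  user 2 has \<open>w = 1 - \<rho>\<close>.
\<close>

definition fdma_rate :: "uplink_system \<Rightarrow> nat \<Rightarrow> real \<Rightarrow> (nat \<Rightarrow> real) \<Rightarrow> real" where
  "fdma_rate S k w q =
     (if w = 0 then 0 else w * log 2 (1 + tx_power S k * gain S k q / (w * noise S)))"

definition fdma_region :: "uplink_system \<Rightarrow> (real \<times> real) set" where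
  "fdma_region S =
     convex hull (\<Union>q\<in>positions S. \<Union>\<rho>\<in>{0..1}.
       {(R1, R2). 0 \<le> R1 \<and> R1 \<le> fdma_rate S 1 \<rho> q \<and>
                  0 \<le> R2 \<and> R2 \<le> fdma_rate S 2 (1 - \<rho>) q})"

definition f_opt :: "uplink_system \<Rightarrow> real \<Rightarrow> real" where
  "f_opt S x =
     (tx_power S 1 * path_gain S / noise S) / (dist_sq S 1 + (x - user_x S 1)\<^sup>2) +
     (tx_power S 2 * path_gain S / noise S) / (dist_sq S 2 + (x - user_x S 2)\<^sup>2)"

definition crit_points :: "uplink_system \<Rightarrow> real set" where
  "crit_points S = {x \<in> {user_x S 1..user_x S 2}. deriv (f_opt S) x = 0}"

text \<open>
  \<open>Max\<close> needs a finite set: for positive parameters the zeros of the derivative of \<open>f_opt S\<close>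
  are the roots of a polynomial of degree 5, so \<open>crit_points S\<close> is finite.
\<close>

definition r_opt :: "uplink_system \<Rightarrow> real" where
  "r_opt S =
     log 2 (1 + real (num_ant S) *
                Max (f_opt S ` (crit_points S \<union> {user_x S 1, user_x S 2})))"

definition outer_bound :: "uplink_system \<Rightarrow> (nat \<Rightarrow> nat \<Rightarrow> real) \<Rightarrow> (real \<times> real) set" where
  "outer_bound S qopt =
     {(R1, R2). 0 \<le> R1 \<and> R1 \<le> user_rate S 1 (qopt 1) \<and>
                0 \<le> R2 \<and> R2 \<le> user_rate S 2 (qopt 2) \<and>
                R1 + R2 \<le> r_opt S}"

end

theory Submission
  imports Defs
begin

text \<open>
  Time sharing between \<open>\<rho> = 1\<close> at \<open>q\<^sub>1\<close> and \<open>\<rho> = 0\<close> at \<open>q\<^sub>2\<close> is a convex combination of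
  two points on the axes, and concavity of the logarithm puts every FDMA rectangle inside the
  pentagon of the same antenna positions. For the outer bound, the triangle inequality and
  Cauchy--Schwarz discard all phases and bound the received signal-to-noise ratio by the sum of
  \<open>f_opt\<close> over the antenna positions. Moving a position to the nearest point of
  \<open>[x\<^sub>1, x\<^sub>2]\<close> does not decrease \<open>f_opt\<close>, and on that interval the maximum is attained at an
  endpoint or at a critical point.
\<close>

text \<open>When both shares are positive this is Jensen's inequality for \<open>log 2\<close> at
  \<open>1 + x / w\<close> and \<open>1 + y / v\<close> with weights \<open>w\<close> and
  \<open>v\<close>: the weighted mean of the points is \<open>1 + x + y\<close>. When one share is
  0, the other is 1 and monotonicity of the logarithm is enough.\<close>

lemma log_bandwidth_share_le:
  fixes w v x y :: real
  assumes "0 \<le> w" "0 \<le> v" "w + v = 1" "0 \<le> x" "0 \<le> y"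
  shows "(if w = 0 then 0 else w * log 2 (1 + x / w)) +
         (if v = 0 then 0 else v * log 2 (1 + y / v)) \<le> log 2 (1 + x + y)"
proof -
  consider "w = 0" | "v = 0" | "w > 0" "v > 0" using assms by linarith
  then show ?thesis
  proof cases
    case 3
    have "w * log 2 (1 + x / w) + v * log 2 (1 + y / v)
        \<le> log 2 (w * (1 + x / w) + v * (1 + y / v))"
    proof -
      have "concave_on {0<..} (log 2 :: real \<Rightarrow> real)"
        by (rule log_concave) auto
      from concave_onD[OF this, of v "1 + x / w" "1 + y / v"] 3 assms
      show ?thesis by (simp add: add_pos_nonneg eq_diff_eq[symmetric])
    qed
    also have "w * (1 + x / w) + v * (1 + y / v) = 1 + x + y"
      using 3 assms(3) by (simp add: distrib_left)
    finally show ?thesis using 3 by simp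
  qed (use assms in auto)
qed

lemma gain_nonneg: "0 \<le> gain S k q"
  by (simp add: gain_def)

lemma user_rate_nonneg:
  assumes "0 \<le> tx_power S k" "0 < noise S"
  shows "0 \<le> user_rate S k q"
  using assms by (auto simp: user_rate_def gain_nonneg intro!: zero_le_log_cancel_iff[THEN iffD2] add_pos_nonneg)

lemma fdma_rate_full: "fdma_rate S k 1 q = user_rate S k q"
  by (simp add: fdma_rate_def user_rate_def)

lemma tdma_subset_fdma:
  assumes rates: "0 \<le> user_rate S 1 (qopt 1)" "0 \<le> user_rate S 2 (qopt 2)"
    and pos: "qopt 1 \<in> positions S" "qopt 2 \<in> positions S"
  shows "tdma_region S qopt \<subseteq> fdma_region S"
proof -
  let ?rect = "\<lambda>q \<rho>. {(R1, R2). 0 \<le> R1 \<and> R1 \<le> fdma_rate S 1 \<rho> q \<and>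
                                0 \<le> R2 \<and> R2 \<le> fdma_rate S 2 (1 - \<rho>) q}"
  have rect: "x \<in> fdma_region S" if "q \<in> positions S" "\<rho> \<in> {0..1}" "x \<in> ?rect q \<rho>" for q \<rho> x
    unfolding fdma_region_def by (rule hull_inc) (use that in blast)
  \<comment> \<open>At an extreme bandwidth split one user keeps the full rate, while the value 0
    set for share 0 puts the other coordinate on the axis.\<close>
  have axis1: "(R, 0) \<in> fdma_region S" if "0 \<le> R" "R \<le> user_rate S 1 (qopt 1)" for R
    using that pos
    by (intro rect[of "qopt 1" 1]) (auto simp: fdma_rate_full, simp add: fdma_rate_def)
  have axis2: "(0, R) \<in> fdma_region S" if "0 \<le> R" "R \<le> user_rate S 2 (qopt 2)" for R
    using that pos
    by (intro rect[of "qopt 2" 0]) (auto simp: fdma_rate_full, simp add: fdma_rate_def)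
  have conv: "convex (fdma_region S)"
    unfolding fdma_region_def by (rule convex_convex_hull)
  show ?thesis
  proof clarify
    fix R1 R2 assume "(R1, R2) \<in> tdma_region S qopt"
    then obtain \<rho> where \<rho>: "0 \<le> \<rho>" "\<rho> \<le> 1"
      and R: "0 \<le> R1" "R1 \<le> \<rho> * user_rate S 1 (qopt 1)"
        "0 \<le> R2" "R2 \<le> (1 - \<rho>) * user_rate S 2 (qopt 2)"
      unfolding tdma_region_def by auto
    \<comment> \<open>The convex combination rescales by \<open>1 / \<rho>\<close> and
      \<open>1 / (1 - \<rho>)\<close>. At either end of the range one divisor vanishes, but there
      the point itself lies on an axis.\<close>
    consider "\<rho> = 0" | "\<rho> = 1" | "0 < \<rho>" "\<rho> < 1" using \<rho> by linarith
    then show "(R1, R2) \<in> fdma_region S"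
    proof cases
      case 1
      then show ?thesis using R axis2[of R2] by simp
    next
      case 2
      then show ?thesis using R axis1[of R1] by simp
    next
      case 3
      have "(R1 / \<rho>, 0) \<in> fdma_region S" "(0, R2 / (1 - \<rho>)) \<in> fdma_region S"
        using R 3 by (auto intro!: axis1 axis2 simp: field_simps)
      from convexD[OF conv this, of \<rho> "1 - \<rho>"] 3 show ?thesis by simp
    qed
  qed
qed

lemma fdma_subset_capacity:
  assumes "0 \<le> tx_power S 1" "0 \<le> tx_power S 2" "0 < noise S"
  shows "fdma_region S \<subseteq> capacity_region S"
  unfolding fdma_region_def capacity_region_def
proof (intro hull_mono UN_mono order_refl, safe)
  fix q \<rho> R1 R2
  assume \<rho>: "\<rho> \<in> {0..1}"
    and R: "0 \<le> R1" "R1 \<le> fdma_rate S 1 \<rho> q" "0 \<le> R2" "R2 \<le> fdma_rate S 2 (1 - \<rho>) q"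
  define snr where "snr k = tx_power S k * gain S k q / noise S" for k
  have snr: "0 \<le> snr 1" "0 \<le> snr 2"
    using assms by (simp_all add: snr_def gain_nonneg)
  have rate: "fdma_rate S k w q = (if w = 0 then 0 else w * log 2 (1 + snr k / w))" for k w
    by (simp add: fdma_rate_def snr_def mult.commute)
  have user: "user_rate S k q = log 2 (1 + snr k)" for k
    by (simp add: user_rate_def snr_def)
  have sum: "sum_rate S q = log 2 (1 + snr 1 + snr 2)"
    by (simp add: sum_rate_def snr_def add_divide_distrib add.assoc)
  \<comment> \<open>The single-user bounds come from the two-user inequality by setting the other
    signal-to-noise ratio to 0.\<close>
  have "fdma_rate S 1 \<rho> q \<le> user_rate S 1 q"
    using log_bandwidth_share_le[of \<rho> "1 - \<rho>" "snr 1" 0] \<rho> snr by (auto simp: rate user simp del: One_nat_def split: if_splits)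
  moreover have "fdma_rate S 2 (1 - \<rho>) q \<le> user_rate S 2 q"
    using log_bandwidth_share_le[of \<rho> "1 - \<rho>" 0 "snr 2"] \<rho> snr by (auto simp: rate user simp del: One_nat_def split: if_splits)
  moreover have "fdma_rate S 1 \<rho> q + fdma_rate S 2 (1 - \<rho>) q \<le> sum_rate S q"
    using log_bandwidth_share_le[of \<rho> "1 - \<rho>" "snr 1" "snr 2"] \<rho> snr by (auto simp: rate sum simp del: One_nat_def split: if_splits)
  ultimately show "(R1, R2) \<in> capacity_at S q"
    using R by (simp add: capacity_at_def)
qed

text \<open>The phase factors have modulus 1, so the triangle inequality leaves a sum of amplitudes.
  Cauchy--Schwarz against the constant 1 costs a factor \<open>N\<close>, which the normalisation
  \<open>1 / sqrt N\<close> of the channel cancels.\<close>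

lemma gain_le_sum:
  assumes "0 \<le> path_gain S" "0 \<le> dist_sq S k"
  shows "gain S k q \<le> (\<Sum>n=1..num_ant S. path_gain S / (dist_sq S k + (q n - user_x S k)\<^sup>2))"
proof -
  define N where "N = num_ant S"
  define r where "r n = sqrt (dist_sq S k + (user_x S k - q n)\<^sup>2)" for n
  define a where "a n = sqrt (path_gain S) / r n" for n
  have norm_exp_phase: "cmod (exp (- \<i> * complex_of_real t)) = 1" for t
    by simp
  have r: "0 \<le> r n" for n
    using assms by (simp add: r_def)
  have "cmod (\<Sum>n=1..N.
        complex_of_real (sqrt (path_gain S)) *
        exp (- \<i> * complex_of_real (wavenum S * r n)) / complex_of_real (r n) *
        exp (- \<i> * complex_of_real (2 * pi * \<bar>q n - q_start S\<bar> / guide_wavelen S)))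
      \<le> (\<Sum>n=1..N. a n)" (is "cmod ?s \<le> _")
    unfolding a_def using r assms
    by (intro sum_norm_le) (simp only: norm_mult norm_divide norm_exp_phase norm_of_real, simp)
  then have "(cmod ?s)\<^sup>2 \<le> (\<Sum>n=1..N. a n)\<^sup>2"
    by (intro power_mono) auto
  also have "\<dots> \<le> real N * (\<Sum>n=1..N. (a n)\<^sup>2)"
    using Cauchy_Schwarz_ineq_sum[of a "\<lambda>_. 1" "{1..N}"] by (simp add: mult.commute)
  \<comment> \<open>For \<open>N = 0\<close> both sides are 0, since division by zero yields
    0.\<close>
  finally have "(cmod ?s)\<^sup>2 / real N \<le> (\<Sum>n=1..N. (a n)\<^sup>2)"
    by (cases "N = 0") (simp_all add: field_simps)
  moreover have "gain S k q = (cmod ?s)\<^sup>2 / real N"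
    unfolding gain_def channel_def N_def[symmetric] r_def[symmetric]
    by (simp add: norm_mult power_mult_distrib norm_divide power_divide)
  moreover have "(a n)\<^sup>2 = path_gain S / (dist_sq S k + (q n - user_x S k)\<^sup>2)" for n
    using assms by (simp add: a_def r_def power_divide power2_commute)
  ultimately show ?thesis by (simp add: N_def)
qed

locale positive_uplink =
  fixes S :: uplink_system
  assumes path_gain_pos: "0 < path_gain S" and noise_pos: "0 < noise S"
    and height_pos: "0 < wg_height S"
    and power_pos: "0 < tx_power S 1" "0 < tx_power S 2"
    and users_ordered: "user_x S 1 \<le> user_x S 2"
begin

lemma dist_sq_pos: "0 < dist_sq S k"
  using height_pos by (simp add: dist_sq_def add_pos_nonneg)

lemma weight_pos:
  "0 < tx_power S 1 * path_gain S / noise S" "0 < tx_power S 2 * path_gain S / noise S"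
  using path_gain_pos noise_pos power_pos by simp_all

lemma denom_pos: "0 < dist_sq S k + (t::real)\<^sup>2"
  using dist_sq_pos[of k] by (simp add: add_pos_nonneg)

text \<open>The explicit derivative gives continuity of \<open>f_opt S\<close>, the first-order
  condition at an interior maximum, and the rational equation satisfied by critical points.\<close>

lemma f_opt_deriv:
  "(f_opt S has_real_derivative
     - 2 * (tx_power S 1 * path_gain S / noise S * (x - user_x S 1) / (dist_sq S 1 + (x - user_x S 1)\<^sup>2)\<^sup>2
      + tx_power S 2 * path_gain S / noise S * (x - user_x S 2) / (dist_sq S 2 + (x - user_x S 2)\<^sup>2)\<^sup>2))
   (at x)"
proof -
  have term_deriv: "((\<lambda>x. c / (D + (x - u)\<^sup>2)) has_real_derivative
      - 2 * (c * (x - u) / (D + (x - u)\<^sup>2)\<^sup>2)) (at x)" if "D + (x - u)\<^sup>2 \<noteq> 0" for c D u :: real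
    by (rule derivative_eq_intros refl | use that in \<open>simp add: power2_eq_square\<close>)+
  show ?thesis
    unfolding f_opt_def[abs_def]
    by (rule DERIV_cong[OF DERIV_add[OF term_deriv term_deriv]])
       (simp_all add: denom_pos less_imp_neq[symmetric] distrib_left del: One_nat_def)
qed

text \<open>Clearing denominators in the derivative gives a polynomial that is positive at \<open>x\<^sub>2 + 1\<close>.\<close>

lemma finite_crit_points: "finite (crit_points S)"
proof -
  define A B where "A = tx_power S 1 * path_gain S / noise S"
    and "B = tx_power S 2 * path_gain S / noise S"
  define L where "L k = [:- user_x S k, 1:]" for k
  define p where "p = smult A (L 1 * ([:dist_sq S 2:] + (L 2)\<^sup>2)\<^sup>2)
                    + smult B (L 2 * ([:dist_sq S 1:] + (L 1)\<^sup>2)\<^sup>2)"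
  have p: "poly p x = A * (x - user_x S 1) * (dist_sq S 2 + (x - user_x S 2)\<^sup>2)\<^sup>2
                    + B * (x - user_x S 2) * (dist_sq S 1 + (x - user_x S 1)\<^sup>2)\<^sup>2" for x
    by (simp add: p_def L_def algebra_simps)
  have "0 < poly p (user_x S 2 + 1)"
    unfolding p A_def B_def
    using weight_pos users_ordered dist_sq_pos
    by (intro add_pos_pos mult_pos_pos zero_less_power) auto
  then have "p \<noteq> 0" by auto
  moreover have "crit_points S \<subseteq> {x. poly p x = 0}"
  proof
    fix x assume "x \<in> crit_points S"
    then have "deriv (f_opt S) x = 0" by (simp add: crit_points_def)
    then have "A * (x - user_x S 1) / (dist_sq S 1 + (x - user_x S 1)\<^sup>2)\<^sup>2
             + B * (x - user_x S 2) / (dist_sq S 2 + (x - user_x S 2)\<^sup>2)\<^sup>2 = 0"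
      unfolding A_def B_def by (simp add: DERIV_imp_deriv[OF f_opt_deriv])
    then show "x \<in> {x. poly p x = 0}"
      using denom_pos[of 1 "x - user_x S 1"] denom_pos[of 2 "x - user_x S 2"]
      by (simp add: p add_frac_eq)
  qed
  ultimately show ?thesis
    using poly_roots_finite finite_subset by blast
qed

text \<open>Compactness provides a maximiser \<open>z\<close>, which is an endpoint or, by Fermat's
  criterion, a critical point. Finiteness of \<open>crit_points S\<close> then makes
  \<open>Max\<close> a genuine upper bound.\<close>

lemma f_opt_le_Max_interval:
  assumes "x \<in> {user_x S 1..user_x S 2}"
  shows "f_opt S x \<le> Max (f_opt S ` (crit_points S \<union> {user_x S 1, user_x S 2}))"
proof -
  have "continuous_on {user_x S 1..user_x S 2} (f_opt S)"
    using f_opt_deriv by (meson DERIV_isCont continuous_at_imp_continuous_on)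
  then obtain z where z: "z \<in> {user_x S 1..user_x S 2}"
    and z_max: "\<And>y. y \<in> {user_x S 1..user_x S 2} \<Longrightarrow> f_opt S y \<le> f_opt S z"
    using continuous_attains_sup[of "{user_x S 1..user_x S 2}" "f_opt S"] users_ordered by auto
  have "z \<in> crit_points S \<union> {user_x S 1, user_x S 2}"
  proof (cases "z = user_x S 1 \<or> z = user_x S 2")
    case False
    \<comment> \<open>This radius keeps the neighbourhood of \<open>z\<close> inside the interval,
      so the maximum over the interval is a local one.\<close>
    then have "0 < min (z - user_x S 1) (user_x S 2 - z)" using z by auto
    moreover have "f_opt S y \<le> f_opt S z" if "\<bar>z - y\<bar> < min (z - user_x S 1) (user_x S 2 - z)" for y
      using that by (intro z_max) (simp add: abs_less_iff)
    ultimately have "deriv (f_opt S) z = 0"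
      using DERIV_local_max[OF f_opt_deriv] DERIV_imp_deriv[OF f_opt_deriv] by metis
    with z show ?thesis by (simp add: crit_points_def)
  qed auto
  then have "f_opt S z \<le> Max (f_opt S ` (crit_points S \<union> {user_x S 1, user_x S 2}))"
    using finite_crit_points by (intro Max_ge) auto
  with z_max[OF assms] show ?thesis by linarith
qed

text \<open>Each summand has a positive weight and decreases with the distance to its own
  user.\<close>

lemma f_opt_mono_dist:
  assumes "\<bar>y - user_x S 1\<bar> \<le> \<bar>x - user_x S 1\<bar>" "\<bar>y - user_x S 2\<bar> \<le> \<bar>x - user_x S 2\<bar>"
  shows "f_opt S x \<le> f_opt S y"
  unfolding f_opt_def
  using assms weight_pos denom_pos
  by (intro add_mono divide_left_mono mult_pos_pos add_left_mono) (auto simp: abs_le_square_iff)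

lemma f_opt_le_Max:
  "f_opt S x \<le> Max (f_opt S ` (crit_points S \<union> {user_x S 1, user_x S 2}))"
proof -
  \<comment> \<open>\<open>y\<close> is the projection of \<open>x\<close> onto the interval. Both
    users sit at its endpoints, so projecting brings \<open>x\<close> no farther from
    either.\<close>
  define y where "y = max (user_x S 1) (min x (user_x S 2))"
  have "f_opt S x \<le> f_opt S y"
    by (rule f_opt_mono_dist) (use users_ordered in \<open>auto simp: y_def max_def min_def\<close>)
  also have "\<dots> \<le> Max (f_opt S ` (crit_points S \<union> {user_x S 1, user_x S 2}))"
    by (rule f_opt_le_Max_interval) (use users_ordered in \<open>auto simp: y_def\<close>)
  finally show ?thesis .
qed

lemma sum_rate_le_r_opt: "sum_rate S q \<le> r_opt S"
proof -
  define M where "M = Max (f_opt S ` (crit_points S \<union> {user_x S 1, user_x S 2}))"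
  define T where "T k n = path_gain S / (dist_sq S k + (q n - user_x S k)\<^sup>2)" for k n
  define G where "G = (tx_power S 1 * gain S 1 q + tx_power S 2 * gain S 2 q) / noise S"
  have gain: "gain S k q \<le> (\<Sum>n=1..num_ant S. T k n)" for k
    unfolding T_def using path_gain_pos dist_sq_pos by (intro gain_le_sum) (auto intro: less_imp_le)
  have "G \<le> (tx_power S 1 * (\<Sum>n=1..num_ant S. T 1 n)
            + tx_power S 2 * (\<Sum>n=1..num_ant S. T 2 n)) / noise S"
    unfolding G_def using gain power_pos noise_pos
    by (intro divide_right_mono add_mono mult_left_mono) auto
  \<comment> \<open>Regrouping by antenna instead of by user turns each antenna's contribution into
    one value of \<open>f_opt S\<close>, to which the bound \<open>M\<close> applies.\<close>
  also have "\<dots> = (\<Sum>n=1..num_ant S. f_opt S (q n))"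
    by (simp add: f_opt_def T_def sum_distrib_left sum_divide_distrib sum.distrib
        add_divide_distrib mult_ac)
  also have "\<dots> \<le> real (num_ant S) * M"
    using sum_bounded_above[of "{1..num_ant S}" "\<lambda>n. f_opt S (q n)" M] f_opt_le_Max
    by (simp add: M_def)
  finally have "G \<le> real (num_ant S) * M" .
  \<comment> \<open>This keeps both logarithm arguments at least 1, so that \<open>log 2\<close>
    preserves the inequality.\<close>
  moreover have "0 \<le> G"
    unfolding G_def using power_pos noise_pos gain_nonneg by simp
  ultimately show ?thesis
    unfolding sum_rate_def r_opt_def G_def[symmetric] M_def[symmetric] by simp
qed

end

text \<open>An intersection of a rectangle and a half-plane. Convexity allows the convex hull in
  \<open>capacity_region\<close> to be bounded one antenna placement at a time.\<close>

lemma convex_outer_bound: "convex (outer_bound S qopt)"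
proof -
  have "outer_bound S qopt =
      ({0..user_rate S 1 (qopt 1)} \<times> {0..user_rate S 2 (qopt 2)}) \<inter> {x. inner (1, 1) x \<le> r_opt S}"
    by (auto simp: outer_bound_def)
  then show ?thesis
    by (simp add: convex_Int convex_Times convex_halfspace_le)
qed

lemma user_rate_mono:
  assumes "0 \<le> tx_power S k" "0 < noise S" "gain S k q \<le> gain S k q'"
  shows "user_rate S k q \<le> user_rate S k q'"
proof -
  have "tx_power S k * gain S k q / noise S \<le> tx_power S k * gain S k q' / noise S"
    using assms by (intro divide_right_mono mult_left_mono) auto
  moreover have "0 \<le> tx_power S k * gain S k q / noise S"
    using assms gain_nonneg by simp
  ultimately show ?thesis
    by (simp add: user_rate_def)
qed

theorem mainTheorem5:
  fixes S :: uplink_system and qopt :: "nat \<Rightarrow> nat \<Rightarrow> real"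
  assumes "num_ant S > 1"
    and "path_gain S > 0" and "noise S > 0" and "wg_height S > 0" and "wavenum S > 0"
    and "guide_wavelen S > 0" and "spacing S > 0"
    and "tx_power S 1 > 0" and "tx_power S 2 > 0"
    and "user_x S 1 \<le> user_x S 2"
    and "{user_x S 1..user_x S 2} \<subseteq> {q_start S..q_end S}"
    and "positions S \<noteq> {}"
    and "\<forall>k\<in>{1, 2}. is_arg_max (gain S k) (\<lambda>q. q \<in> positions S) (qopt k)"
  shows "tdma_region S qopt \<subseteq> fdma_region S \<and>
         fdma_region S \<subseteq> capacity_region S \<and>
         capacity_region S \<subseteq> outer_bound S qopt"
proof (intro conjI)
  interpret positive_uplink S
    by unfold_locales (use assms in auto)
  have opt: "qopt k \<in> positions S" "\<And>q. q \<in> positions S \<Longrightarrow> gain S k q \<le> gain S k (qopt k)"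
    if "k \<in> {1, 2}" for k
    using bspec[OF assms(13) that] by (auto simp: is_arg_max_linorder)
  show "tdma_region S qopt \<subseteq> fdma_region S"
    using power_pos noise_pos opt(1)
    by (intro tdma_subset_fdma user_rate_nonneg) auto
  show "fdma_region S \<subseteq> capacity_region S"
    using power_pos noise_pos by (intro fdma_subset_capacity) auto
  have "capacity_at S q \<subseteq> outer_bound S qopt" if q: "q \<in> positions S" for q
  proof -
    have "user_rate S 1 q \<le> user_rate S 1 (qopt 1)" "user_rate S 2 q \<le> user_rate S 2 (qopt 2)"
      using power_pos noise_pos opt(2) q by (auto intro!: user_rate_mono)
    then show ?thesis
      using sum_rate_le_r_opt[of q] by (auto simp: capacity_at_def outer_bound_def)
  qed
  then show "capacity_region S \<subseteq> outer_bound S qopt"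
    unfolding capacity_region_def by (intro hull_minimal UN_least convex_outer_bound)
qed

end
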